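(* Let $X$ be a compact metric space and $F\colon X\to 2^X$ a set-valued mapping such that the set of points of $X$ having at least one periodic orbit is dense in $X$. Then there exists an $F$-invariant Borel probability measure with full support; consequently the set of $F$-invariant measures with full support is a dense $G_\delta$ subset of the space of $F$-invariant Borel probability measures on $X$ (with the weak$^*$ topology).
   Context: $2^X$ is the space of nonempty closed subsets of $X$; a set-valued mapping is an upper semicontinuous $F\colon X\to 2^X$; $F^{-1}(B)=\{y\in X: F(y)\cap B\neq\emptyset\}$. An orbit of $x$ is a sequence $(x_j)_{j=0}^\infty$ with $x_0=x$, $x_{j+1}\in F(x_j)$; it is periodic if there is $p\in\mathbb{N}$ with $x_{j+p}=x_j$ for all $j\ge0$. A Borel probability measure $\mu$ on $X$ is $F$-invariant if $\mu(B)\le\mu(F^{-1}(B))$ for every Borel set $B$; it has full support if $\mu(U)>0$ for every nonempty open $U$. *)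

theory Defs
  imports "HOL-Probability.Probability"
begin

definition set_valued_map :: "('a::metric_space \<Rightarrow> 'a set) \<Rightarrow> bool" where
  "set_valued_map F \<longleftrightarrow>
     (\<forall>x. F x \<noteq> {} \<and> closed (F x)) \<and>
     (\<forall>U. open U \<longrightarrow> open {x. F x \<subseteq> U})"

definition preimage_sv :: "('a \<Rightarrow> 'a set) \<Rightarrow> 'a set \<Rightarrow> 'a set" where
  "preimage_sv F B = {y. F y \<inter> B \<noteq> {}}"

definition is_orbit :: "('a \<Rightarrow> 'a set) \<Rightarrow> 'a \<Rightarrow> (nat \<Rightarrow> 'a) \<Rightarrow> bool" where
  "is_orbit F x xs \<longleftrightarrow> xs 0 = x \<and> (\<forall>j. xs (Suc j) \<in> F (xs j))"

definition periodic_seq :: "(nat \<Rightarrow> 'a) \<Rightarrow> bool" where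
  "periodic_seq xs \<longleftrightarrow> (\<exists>p>0. \<forall>j. xs (j + p) = xs j)"

definition has_periodic_orbit :: "('a \<Rightarrow> 'a set) \<Rightarrow> 'a \<Rightarrow> bool" where
  "has_periodic_orbit F x \<longleftrightarrow> (\<exists>xs. is_orbit F x xs \<and> periodic_seq xs)"

definition borel_prob :: "'a::topological_space measure \<Rightarrow> bool" where
  "borel_prob M \<longleftrightarrow> prob_space M \<and> sets M = sets borel"

text \<open>F-invariance. For a Borel set B, the set F^{-1}(B) is analytic, hence
  universally measurable; its measure is taken in the completion of M.\<close>
definition invariant_measure :: "('a::metric_space \<Rightarrow> 'a set) \<Rightarrow> 'a measure \<Rightarrow> bool" where
  "invariant_measure F M \<longleftrightarrow> borel_prob M \<and>
     (\<forall>B\<in>sets borel. measure M B \<le> measure (completion M) (preimage_sv F B))"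

definition full_support :: "'a::topological_space measure \<Rightarrow> bool" where
  "full_support M \<longleftrightarrow> (\<forall>U. open U \<and> U \<noteq> {} \<longrightarrow> measure M U > 0)"

definition weak_star_topology :: "'a::metric_space measure set \<Rightarrow> 'a measure topology" where
  "weak_star_topology P = topology_generated_by
     {{M \<in> P. (\<integral>x. f x \<partial>M) \<in> V} | f V. continuous_on UNIV f \<and> open (V :: real set)}"

end

theory Submission
  imports Defs
begin

text \<open>
  Averaging the uniform measures along countably many periodic orbits whose points are dense gives an
  invariant measure \<open>N\<close> of full support. Full support is the condition that countably many balls have
  positive mass, and each of these conditions is weak* open; if \<open>M\<close> is invariant, then
  \<open>(1 - t) M + t N\<close> is invariant of full support and tends to \<open>M\<close> as \<open>t\<close> tends to \<open>0\<close>.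

  The invariance of the mixture is the delicate point: \<open>measure (completion M) E = 0\<close> when \<open>E\<close> is not
  measurable, so one has to know that \<open>F\<^sup>-\<^sup>1(B)\<close> is universally measurable for every Borel set \<open>B\<close>.
  This follows from Choquet's capacitability argument for the set function \<open>A \<mapsto> \<mu>\<^sup>*(F\<^sup>-\<^sup>1(A))\<close>, which
  is continuous along increasing sequences of sets and along decreasing sequences of compact sets.
\<close>

section \<open>Souslin schemes for Borel sets\<close>

text \<open>
  A Souslin scheme made monotone in every index. The monotonicity lets the capacitability argument
  choose the indices one after the other and spares it the compactness of a finitely branching tree.
\<close>
definition approx_scheme :: "'a::topological_space set \<Rightarrow> (nat \<Rightarrow> (nat \<Rightarrow> nat) \<Rightarrow> 'a set) \<Rightarrow> bool" where
  "approx_scheme A H \<longleftrightarrow>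
     (\<forall>s. H 0 s = A) \<and>
     (\<forall>k s t. (\<forall>i<k. s i \<le> t i) \<longrightarrow> H k s \<subseteq> H k t) \<and>
     (\<forall>k s. H k s = (\<Union>n. H (Suc k) (s(k := n)))) \<and>
     (\<forall>s. (\<Inter>k. closure (H k s)) \<subseteq> A)"

context
  fixes A :: "'a::topological_space set" and H
  assumes H: "approx_scheme A H"
begin

lemma approx_scheme_0: "H 0 s = A"
  using conjunct1[OF H[unfolded approx_scheme_def]] by blast

lemma approx_scheme_mono: "(\<And>i. i < k \<Longrightarrow> s i \<le> t i) \<Longrightarrow> H k s \<subseteq> H k t"
  using conjunct1[OF conjunct2[OF H[unfolded approx_scheme_def]]] by blast

lemma approx_scheme_split: "H k s = (\<Union>n. H (Suc k) (s(k := n)))"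
  using conjunct1[OF conjunct2[OF conjunct2[OF H[unfolded approx_scheme_def]]]] by (elim allE)

lemma approx_scheme_closure: "(\<And>k. x \<in> closure (H k s)) \<Longrightarrow> x \<in> A"
  using conjunct2[OF conjunct2[OF conjunct2[OF H[unfolded approx_scheme_def]]]] by blast

lemma approx_scheme_cong: "(\<And>i. i < k \<Longrightarrow> s i = t i) \<Longrightarrow> H k s = H k t"
  by (intro subset_antisym approx_scheme_mono) auto

text \<open>Choosing \<open>n = s k\<close> in the splitting of \<open>H k s\<close> leaves
  \<open>s\<close> unchanged.\<close>

lemma approx_scheme_decseq: "decseq (\<lambda>k. H k s)"
proof (rule decseq_SucI)
  show "H (Suc k) s \<subseteq> H k s" for k
    by (subst (2) approx_scheme_split) (metis UN_upper UNIV_I fun_upd_triv)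
qed

end

lemma approx_scheme_closed: "closed A \<Longrightarrow> approx_scheme A (\<lambda>_ _. A)"
  by (auto simp: approx_scheme_def)

text \<open>The first index only bounds which \<open>A i\<close> are used: taking all
  \<open>i \<le> s 0\<close> instead of \<open>i = s 0\<close> makes the scheme monotone in that
  index. The union stays finite, so it commutes with closure, and a point in all the closures meets
  some fixed \<open>i\<close> at infinitely many levels by pigeonhole; as the levels decrease, that
  \<open>i\<close> serves at every level.\<close>

lemma approx_scheme_UN:
  fixes A :: "nat \<Rightarrow> 'a::topological_space set"
  assumes H: "\<And>i. approx_scheme (A i) (H i)"
  defines "G \<equiv> \<lambda>k s. case k of 0 \<Rightarrow> (\<Union>i. A i) | Suc m \<Rightarrow> (\<Union>i\<le>s 0. H i m (s \<circ> Suc))"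
  shows "approx_scheme (\<Union>i. A i) G"
  unfolding approx_scheme_def
proof (intro conjI allI impI)
  show "G 0 s = (\<Union>i. A i)" for s
    by (simp add: G_def)
  show "G k s \<subseteq> G k t" if "\<forall>i<k. s i \<le> t i" for k s t
  proof (cases k)
    case (Suc m)
    have "H i m (s \<circ> Suc) \<subseteq> H i m (t \<circ> Suc)" for i
      using that Suc by (intro approx_scheme_mono[OF H]) auto
    moreover have "s 0 \<le> t 0" using that Suc by auto
    ultimately show ?thesis
      by (simp add: G_def Suc) (meson UN_mono atMost_subset_iff)
  qed (simp add: G_def)
  show "G k s = (\<Union>n. G (Suc k) (s(k := n)))" for k s
  proof (cases k)
    case 0
    then show ?thesis
      by (auto simp: G_def approx_scheme_0[OF H])
  next
    case (Suc m)
    have "H i m (s \<circ> Suc) = (\<Union>n. H i (Suc m) (s(Suc m := n) \<circ> Suc))" for i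
    proof -
      have "s(Suc m := n) \<circ> Suc = (s \<circ> Suc)(m := n)" for n
        by auto
      then show ?thesis using approx_scheme_split[OF H, of i m "s \<circ> Suc"] by simp
    qed
    then show ?thesis
      by (simp add: G_def Suc) blast
  qed
  show "(\<Inter>k. closure (G k s)) \<subseteq> (\<Union>i. A i)" for s
  proof
    fix x assume x: "x \<in> (\<Inter>k. closure (G k s))"
    have "\<exists>i\<in>{..s 0}. x \<in> closure (H i m (s \<circ> Suc))" for m
    proof -
      have "x \<in> closure (\<Union>i\<le>s 0. H i m (s \<circ> Suc))"
        using INT_D[OF x, of "Suc m"] by (simp add: G_def)
      moreover have "closure (\<Union>i\<le>s 0. H i m (s \<circ> Suc)) \<subseteq> (\<Union>i\<le>s 0. closure (H i m (s \<circ> Suc)))"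
        by (intro closure_minimal UN_mono closure_subset closed_UN) auto
      ultimately show ?thesis by blast
    qed
    then obtain j where j: "\<And>m. j m \<le> s 0" "\<And>m. x \<in> closure (H (j m) m (s \<circ> Suc))"
      by (metis atMost_iff)
    have "\<exists>i\<in>{..s 0}. infinite {m \<in> UNIV. j m = i}"
      by (rule pigeonhole_infinite_rel) (use j in auto)
    then obtain i where i: "infinite {m. j m = i}" by auto
    have "x \<in> closure (H i k (s \<circ> Suc))" for k
    proof -
      obtain m where m: "k \<le> m" "j m = i"
        using i unfolding infinite_nat_iff_unbounded_le by auto
      then show ?thesis
        using j(2)[of m] closure_mono[OF decseqD[OF approx_scheme_decseq[OF H] m(1)]] by auto
    qed
    then have "x \<in> A i" by (rule approx_scheme_closure[OF H])
    then show "x \<in> (\<Union>i. A i)" by blast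
  qed
qed

lemma prod_encode_less_iff: "prod_encode (i, m) < prod_encode (i, n) \<longleftrightarrow> m < n"
proof -
  have "strict_mono (\<lambda>m. prod_encode (i, m))"
    by (rule strict_monoI_Suc) (simp add: prod_encode_def)
  from strict_mono_less[OF this] show ?thesis .
qed

lemma approx_scheme_INT:
  fixes A :: "nat \<Rightarrow> 'a::topological_space set"
  assumes H: "\<And>i. approx_scheme (A i) (H i)"
  shows "\<exists>G. approx_scheme (\<Inter>i. A i) G"
proof -
  \<comment> \<open>The index sequence \<open>s\<close> is split into one sequence for each \<open>A i\<close>; its first \<open>k\<close> terms
    determine the first \<open>c i k\<close> terms of the \<open>i\<close>-th one.\<close>
  define c where "c i k = (LEAST m. k \<le> prod_encode (i, m))" for i k
  have c: "m < c i k \<longleftrightarrow> prod_encode (i, m) < k" for m i k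
  proof
    show "m < c i k \<Longrightarrow> prod_encode (i, m) < k"
      unfolding c_def by (metis not_less_Least not_le)
    have "k \<le> prod_encode (i, c i k)"
      unfolding c_def by (rule LeastI[of _ k]) (rule le_prod_encode_2)
    then show "prod_encode (i, m) < k \<Longrightarrow> m < c i k"
      by (metis order_less_le_trans prod_encode_less_iff)
  qed
  have c_eqI: "c i k = m" if "\<And>n. n < m \<longleftrightarrow> prod_encode (i, n) < k" for i k m
    using c[of _ i k] that by (metis linorder_neqE_nat less_irrefl)
  define G where "G k s = (\<Inter>i. H i (c i k) (\<lambda>m. s (prod_encode (i, m))))" for k and s :: "nat \<Rightarrow> nat"
  have "approx_scheme (\<Inter>i. A i) G"
    unfolding approx_scheme_def
  proof (intro conjI allI impI)
    have "c i 0 = 0" for i by (rule c_eqI) auto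
    then show "G 0 s = (\<Inter>i. A i)" for s
      by (simp add: G_def approx_scheme_0[OF H])
    show "G k s \<subseteq> G k t" if "\<forall>i<k. s i \<le> t i" for k s t
      unfolding G_def using that by (intro INF_mono' approx_scheme_mono[OF H]) (auto simp: c)
    show "G k s = (\<Union>n. G (Suc k) (s(k := n)))" for k s
    proof -
      \<comment> \<open>Every \<open>k\<close> encodes exactly one pair, so passing from
        \<open>k\<close> to \<open>Suc k\<close> fixes one more index for \<open>A i0\<close> alone;
        all other factors of the intersection stay as they are.\<close>
      obtain i0 m0 where k: "k = prod_encode (i0, m0)"
        by (metis prod_decode_inverse surj_pair)
      let ?t = "\<lambda>i m. s (prod_encode (i, m))"
      have 1: "c i0 k = m0" "c i0 (Suc k) = Suc m0"
        by (rule c_eqI; auto simp: k prod_encode_less_iff less_Suc_eq)+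
      have 2: "c i (Suc k) = c i k" if "i \<noteq> i0" for i
        by (rule c_eqI) (use that in \<open>auto simp: c k less_Suc_eq\<close>)
      have 3: "(\<lambda>m. (s(k := n)) (prod_encode (i, m))) = (if i = i0 then (?t i0)(m0 := n) else ?t i)" for n i
        by (auto simp: k)
      have "G (Suc k) (s(k := n)) = H i0 (Suc m0) ((?t i0)(m0 := n)) \<inter> (\<Inter>i\<in>-{i0}. H i (c i k) (?t i))" for n
        unfolding G_def 3 by (auto simp: 1 2 split: if_splits) (metis 2)
      moreover have "G k s = H i0 m0 (?t i0) \<inter> (\<Inter>i\<in>-{i0}. H i (c i k) (?t i))"
        unfolding G_def using 1 by auto
      ultimately show ?thesis
        using approx_scheme_split[OF H, of i0 m0 "?t i0"] by auto
    qed
    show "(\<Inter>k. closure (G k s)) \<subseteq> (\<Inter>i. A i)" for s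
    proof (intro subsetI INT_I)
      fix x i assume x: "x \<in> (\<Inter>k. closure (G k s))"
      show "x \<in> A i"
      proof (rule approx_scheme_closure[OF H])
        fix m
        \<comment> \<open>At this level exactly \<open>m\<close> indices of the \<open>i\<close>-th
          sequence are fixed, so the closures of \<open>G\<close> control every level of
          \<open>H i\<close>.\<close>
        have "c i (prod_encode (i, m)) = m"
          by (rule c_eqI) (simp add: prod_encode_less_iff)
        then have "G (prod_encode (i, m)) s \<subseteq> H i m (\<lambda>m. s (prod_encode (i, m)))"
          unfolding G_def by (intro INF_lower2[of i]) simp_all
        then show "x \<in> closure (H i m (\<lambda>m. s (prod_encode (i, m))))"
          using x closure_mono by blast
      qed
    qed
  qed
  then show ?thesis by blast
qed

text \<open>Having a scheme is stable under countable unions and intersections but is not visibly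
  stable under complements, so the induction carries a scheme for the set and one for its
  complement. Open sets enter as countable unions of closed sets.\<close>

lemma borel_approx_scheme:
  fixes B :: "'a::metric_space set"
  assumes "B \<in> sets borel"
  shows "\<exists>H. approx_scheme B H"
proof -
  have UN: "\<exists>H. approx_scheme (\<Union>i. A i) H" if *: "\<And>i. \<exists>H. approx_scheme (A i) H" for A :: "nat \<Rightarrow> 'a set"
  proof -
    obtain H where "\<And>i. approx_scheme (A i) (H i)" using * by metis
    then show ?thesis using approx_scheme_UN[of A H] by blast
  qed
  have INT: "\<exists>H. approx_scheme (\<Inter>i. A i) H" if *: "\<And>i. \<exists>H. approx_scheme (A i) H" for A :: "nat \<Rightarrow> 'a set"
  proof -
    obtain H where "\<And>i. approx_scheme (A i) (H i)" using * by metis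
    then show ?thesis using approx_scheme_INT[of A H] by blast
  qed
  have op: "\<exists>H. approx_scheme U H" if "open U" for U :: "'a set"
  proof -
    have "fsigma_in euclidean U"
      using that by (simp add: open_imp_fsigma_in metrizable_space_euclidean)
    then obtain C where "\<And>n::nat. closed (C n)" "\<Union> (range C) = U"
      unfolding fsigma_in_ascending by auto
    then show ?thesis using UN[of C] approx_scheme_closed by metis
  qed
  have "B \<in> sigma_sets UNIV {S. open S}"
    using assms by (simp add: borel_def)
  then have "(\<exists>H. approx_scheme B H) \<and> (\<exists>H. approx_scheme (-B) H)"
  proof induction
    case (Basic a)
    then show ?case using op approx_scheme_closed[of "-a"] by auto
  next
    case Empty
    then show ?case using approx_scheme_closed[of "{}::'a set"] approx_scheme_closed[of "UNIV::'a set"] by auto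
  next
    case (Compl a)
    then show ?case by (simp add: Compl_eq_Diff_UNIV[symmetric])
  next
    case (Union a)
    then show ?case using UN[of a] INT[of "\<lambda>i. - a i"] by simp
  qed
  then show ?thesis by blast
qed

section \<open>Capacitability and universal measurability of preimages\<close>

text \<open>Continuity along increasing unions lets each index be chosen so that \<open>c\<close>
  stays strictly above \<open>t\<close>. The closures along the resulting index sequence decrease to
  a closed subset of \<open>A\<close>, and continuity from above keeps the weak inequality
  there.\<close>

lemma approx_scheme_capacitable:
  fixes c :: "'a::topological_space set \<Rightarrow> 'b::complete_linorder"
  assumes H: "approx_scheme A H"
    and mono: "\<And>S T. S \<subseteq> T \<Longrightarrow> c S \<le> c T"
    and inc: "\<And>S. incseq S \<Longrightarrow> c (\<Union>n. S n) \<le> (SUP n. c (S n))"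
    and dec: "\<And>K. decseq K \<Longrightarrow> (\<And>n. closed (K n)) \<Longrightarrow> (INF n. c (K n)) \<le> c (\<Inter>n. K n)"
    and t: "t < c A"
  shows "\<exists>K\<subseteq>A. closed K \<and> t \<le> c K"
proof -
  have "\<exists>f. \<forall>k. t < c (H k (f k)) \<and> (\<exists>n. f (Suc k) = (f k)(k := n))"
  proof (rule dependent_nat_choice)
    show "\<exists>s. t < c (H 0 s)" using t by (simp add: approx_scheme_0[OF H])
    fix s k assume *: "t < c (H k s)"
    have "incseq (\<lambda>n. H (Suc k) (s(k := n)))"
      by (intro incseq_SucI approx_scheme_mono[OF H]) auto
    from inc[OF this] * have "t < (SUP n. c (H (Suc k) (s(k := n))))"
      by (simp add: approx_scheme_split[OF H, symmetric])
    then obtain n where "t < c (H (Suc k) (s(k := n)))"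
      by (auto simp: less_SUP_iff)
    then show "\<exists>u. t < c (H (Suc k) u) \<and> (\<exists>n. u = s(k := n))"
      by blast
  qed
  then obtain f n where f: "\<And>k. t < c (H k (f k))" "\<And>k. f (Suc k) = (f k)(k := n k)"
    by metis
  \<comment> \<open>Later choices only alter positions from \<open>k\<close> on, and
    \<open>H k\<close> looks only at positions below \<open>k\<close>; so all the \<open>f k\<close>
    can be replaced by the single sequence \<open>n\<close>.\<close>
  have "f k i = n i" if "i < k" for i k
    using that by (induction k) (auto simp: f(2) less_Suc_eq)
  then have "H k (f k) = H k n" for k
    by (intro approx_scheme_cong[OF H]) auto
  with f have n: "t < c (H k n)" for k by metis
  define K where "K = (\<Inter>k. closure (H k n))"
  have "decseq (\<lambda>k. closure (H k n))"
    using approx_scheme_decseq[OF H] by (auto simp: decseq_def intro!: closure_mono)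
  then have "(INF k. c (closure (H k n))) \<le> c K"
    unfolding K_def by (rule dec) simp
  moreover have "t \<le> (INF k. c (closure (H k n)))"
    by (intro INF_greatest) (meson n mono closure_subset less_imp_le order_trans)
  moreover have "K \<subseteq> A"
    unfolding K_def using approx_scheme_closure[OF H] by blast
  ultimately show ?thesis
    by (intro exI[of _ K]) (auto simp: K_def)
qed

lemma closed_preimage_sv:
  assumes "set_valued_map F" "closed K"
  shows "closed (preimage_sv F K)"
proof -
  have "open {x. F x \<subseteq> - K}"
    using assms by (auto simp: set_valued_map_def)
  moreover have "preimage_sv F K = - {x. F x \<subseteq> - K}"
    by (auto simp: preimage_sv_def)
  ultimately show ?thesis by (simp add: closed_open)
qed

text \<open>The values \<open>F x\<close> are compact, so if \<open>F x\<close> meets every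
  \<open>K n\<close>, the finite intersection property gives a common point.\<close>

lemma preimage_sv_INT_decseq:
  fixes F :: "'a::metric_space \<Rightarrow> 'a set"
  assumes "compact (UNIV :: 'a set)" "set_valued_map F"
    and K: "decseq K" "\<And>n::nat. closed (K n)"
  shows "preimage_sv F (\<Inter>n. K n) = (\<Inter>n. preimage_sv F (K n))"
proof (intro subset_antisym subsetI)
  fix x assume x: "x \<in> (\<Inter>n. preimage_sv F (K n))"
  have "closed (F x)" using assms(2) by (simp add: set_valued_map_def)
  then have "compact (F x)"
    using compact_Int_closed[OF assms(1), of "F x"] by simp
  then have "F x \<inter> (\<Inter>n\<in>UNIV. K n) \<noteq> {}"
  proof (rule compact_imp_fip_image)
    fix I :: "nat set" assume "finite I"
    then obtain m where "\<And>n. n \<in> I \<Longrightarrow> n \<le> m"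
      using finite_nat_set_iff_bounded_le by auto
    then have "K m \<subseteq> (\<Inter>n\<in>I. K n)"
      using decseqD[OF K(1)] by blast
    moreover have "F x \<inter> K m \<noteq> {}"
      using INT_D[OF x, of m] by (simp add: preimage_sv_def)
    ultimately show "F x \<inter> (\<Inter>n\<in>I. K n) \<noteq> {}" by blast
  qed (use K in auto)
  then show "x \<in> preimage_sv F (\<Inter>n. K n)"
    by (simp add: preimage_sv_def)
qed (auto simp: preimage_sv_def)

lemma preimage_sv_mono: "A \<subseteq> B \<Longrightarrow> preimage_sv F A \<subseteq> preimage_sv F B"
  by (auto simp: preimage_sv_def)

lemma borel_prob_space: "borel_prob M \<Longrightarrow> space M = UNIV"
  unfolding borel_prob_def by (metis sets_eq_imp_space_eq space_borel)

text \<open>A measurable hull \<open>U\<close> of \<open>E\<close> has the outer measure of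
  \<open>E\<close>, and a countable union \<open>S\<close> of inner approximations reaches the same
  value. Thus \<open>E\<close> lies between \<open>S\<close> and \<open>U\<close>, which differ by a
  null set.\<close>

lemma sets_completion_inner_approx:
  assumes "finite_measure M" "E \<subseteq> space M"
    and inner: "\<And>t. t < outer_measure_of M E \<Longrightarrow> \<exists>L\<in>sets M. L \<subseteq> E \<and> t \<le> emeasure M L"
  shows "E \<in> sets (completion M)"
proof -
  interpret finite_measure M by fact
  obtain U where U: "U \<in> sets M" "E \<subseteq> U" "outer_measure_of M E = emeasure M U"
    using outer_measure_of_attain[OF assms(2)] by blast
  have "\<exists>L\<in>sets M. L \<subseteq> E \<and> emeasure M U \<le> emeasure M L + ennreal (1 / Suc n)" for n
  \<comment> \<open>If \<open>U\<close> is null, no \<open>t\<close> lies strictly below its measure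
    and \<open>inner\<close> gives nothing; the empty set will do.\<close>
  proof (cases "emeasure M U = 0")
    case False
    have "emeasure M U - ennreal (1 / Suc n) < emeasure M U"
      using False by (intro ennreal_between) (auto simp: less_top[symmetric] zero_less_iff_neq_zero)
    with inner U(3) obtain L where "L \<in> sets M" "L \<subseteq> E" "emeasure M U - ennreal (1 / Suc n) \<le> emeasure M L"
      by metis
    then show ?thesis
      by (intro bexI[of _ L]) (auto simp: ennreal_minus_le_iff add.commute)
  qed auto
  then obtain L where L: "\<And>n. L n \<in> sets M" "\<And>n. L n \<subseteq> E"
    "\<And>n. emeasure M U \<le> emeasure M (L n) + ennreal (1 / Suc n)"
    by metis
  define S where "S = (\<Union>n. L n)"
  have S: "S \<in> sets M" "S \<subseteq> E" using L by (auto simp: S_def)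
  have "measure M U \<le> measure M S + 1 / Suc n" for n
  proof -
    have "emeasure M (L n) \<le> emeasure M S"
      using S by (intro emeasure_mono) (auto simp: S_def)
    with L(3)[of n] have "emeasure M U \<le> emeasure M S + ennreal (1 / Suc n)"
      by (meson add_right_mono order_trans)
    then show ?thesis
      by (simp add: emeasure_eq_measure flip: ennreal_plus)
  qed
  then have "measure M U \<le> measure M S"
    by (rule_tac LIMSEQ_le_const[OF LIMSEQ_inverse_real_of_nat_add[of "measure M S"]])
       (auto simp: inverse_eq_divide)
  moreover have "measure M (U - S) = measure M U - measure M S"
    using U S by (intro finite_measure_Diff) auto
  ultimately have "measure M (U - S) = 0"
    using measure_nonneg[of M "U - S"] by linarith
  then have "U - S \<in> null_sets M"
    using U S by (auto simp: null_sets_def emeasure_eq_measure)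
  then show ?thesis
    using U S by (intro sets_completionI[of E S "E - S" "U - S"]) auto
qed

text \<open>Preimages of closed sets are closed, hence measurable, so a closed \<open>K\<close>
  inside \<open>B\<close> that almost exhausts the capacity yields a measurable inner approximation
  of the preimage of \<open>B\<close>.\<close>

proposition preimage_sv_sets_completion:
  fixes F :: "'a::metric_space \<Rightarrow> 'a set"
  assumes cpt: "compact (UNIV :: 'a set)" and F: "set_valued_map F"
    and M: "borel_prob M" and B: "B \<in> sets borel"
  shows "preimage_sv F B \<in> sets (completion M)"
proof (rule sets_completion_inner_approx)
  interpret prob_space M using M by (simp add: borel_prob_def)
  have sets_M: "sets M = sets borel" and space_M: "space M = UNIV"
    using M borel_prob_space by (auto simp: borel_prob_def)
  have closed_sets: "preimage_sv F K \<in> sets M" if "closed K" for K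
    using closed_preimage_sv[OF F that] by (simp add: sets_M)
  show "finite_measure M" by unfold_locales
  show "preimage_sv F B \<subseteq> space M" by (simp add: space_M)
  fix t assume t: "t < outer_measure_of M (preimage_sv F B)"
  obtain H where H: "approx_scheme B H" using borel_approx_scheme[OF B] by blast
  have "\<exists>K\<subseteq>B. closed K \<and> t \<le> outer_measure_of M (preimage_sv F K)"
  proof (rule approx_scheme_capacitable[where c = "\<lambda>S. outer_measure_of M (preimage_sv F S)", OF H _ _ _ t])
    show "outer_measure_of M (preimage_sv F S) \<le> outer_measure_of M (preimage_sv F T)" if "S \<subseteq> T" for S T
      by (intro outer_measure_of_mono preimage_sv_mono that)
    show "outer_measure_of M (preimage_sv F (\<Union>n. S n)) \<le> (SUP n. outer_measure_of M (preimage_sv F (S n)))"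
      if "incseq S" for S :: "nat \<Rightarrow> 'a set"
    proof -
      have "preimage_sv F (\<Union>n. S n) = (\<Union>n. preimage_sv F (S n))"
        by (auto simp: preimage_sv_def)
      moreover have "incseq (\<lambda>n. preimage_sv F (S n))"
        using that by (auto simp: incseq_def intro!: preimage_sv_mono)
      \<comment> \<open>The sets \<open>S n\<close> are arbitrary, so continuity from below is
        needed for outer measure on possibly nonmeasurable sets.\<close>
      ultimately show ?thesis
        by (simp add: SUP_outer_measure_of_incseq space_M)
    qed
    show "(INF n. outer_measure_of M (preimage_sv F (K n))) \<le> outer_measure_of M (preimage_sv F (\<Inter>n. K n))"
      if K: "decseq K" "\<And>n. closed (K n)" for K :: "nat \<Rightarrow> 'a set"
    proof -
      have "decseq (\<lambda>n. preimage_sv F (K n))"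
        using K by (auto simp: decseq_def intro!: preimage_sv_mono)
      then have "(INF n. emeasure M (preimage_sv F (K n))) = emeasure M (\<Inter>n. preimage_sv F (K n))"
        using K by (intro INF_emeasure_decseq) (auto intro!: closed_sets)
      then show ?thesis
        using K by (simp add: closed_sets closed_INT flip: preimage_sv_INT_decseq[OF cpt F K])
    qed
  qed
  then obtain K where "K \<subseteq> B" "closed K" "t \<le> outer_measure_of M (preimage_sv F K)"
    by blast
  then show "\<exists>L\<in>sets M. L \<subseteq> preimage_sv F B \<and> t \<le> emeasure M L"
    by (intro bexI[of _ "preimage_sv F K"] conjI preimage_sv_mono) (simp_all add: closed_sets)
qed

section \<open>Convex combinations of measures\<close>

text \<open>This is \<open>(1 - t) M + t N\<close>: a coin with success probability \<open>t\<close>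
  selects \<open>N\<close>, otherwise \<open>M\<close>. Written as a monadic bind, it inherits its
  measure and integral formulas from those of the bind.\<close>

definition mix_measure :: "real \<Rightarrow> 'a measure \<Rightarrow> 'a measure \<Rightarrow> 'a measure" where
  "mix_measure t M N = measure_pmf (bernoulli_pmf t) \<bind> (\<lambda>b. if b then N else M)"

context
  fixes t :: real and M N :: "'a::topological_space measure"
  assumes t: "0 \<le> t" "t \<le> 1" and M: "borel_prob M" and N: "borel_prob N"
begin

lemma mix_kernel: "(\<lambda>b. if b then N else M) \<in> measure_pmf (bernoulli_pmf t) \<rightarrow>\<^sub>M subprob_algebra borel"
proof -
  have "subprob_space M" "subprob_space N"
    using M N by (auto simp: borel_prob_def prob_space_imp_subprob_space)
  then show ?thesis
    using M N by (simp add: borel_prob_def space_subprob_algebra Pi_iff)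
qed

lemma borel_prob_mix_measure: "borel_prob (mix_measure t M N)"
proof -
  have "prob_space (mix_measure t M N)"
    unfolding mix_measure_def
    by (rule measure_pmf.prob_space_bind[OF _ mix_kernel]) (use M N in \<open>auto simp: borel_prob_def\<close>)
  moreover have "sets (mix_measure t M N) = sets borel"
    unfolding mix_measure_def by (rule sets_bind) (use M N in \<open>auto simp: borel_prob_def\<close>)
  ultimately show ?thesis by (simp add: borel_prob_def)
qed

lemma measure_mix_measure:
  "B \<in> sets borel \<Longrightarrow> measure (mix_measure t M N) B = (1 - t) * measure M B + t * measure N B"
  unfolding mix_measure_def
  using t by (subst measure_pmf.measure_bind[OF mix_kernel]) (auto simp: algebra_simps)

lemma integral_mix_measure:
  fixes f :: "'a \<Rightarrow> real"
  assumes "f \<in> borel_measurable borel" "\<And>x. \<bar>f x\<bar> \<le> c"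
  shows "integral\<^sup>L (mix_measure t M N) f = (1 - t) * integral\<^sup>L M f + t * integral\<^sup>L N f"
  unfolding mix_measure_def
proof (subst integral_bind[where K = borel and B = c and B' = 1, OF assms(1) _ mix_kernel])
  show "\<bar>f x\<bar> \<le> c" for x
    by (rule assms(2))
qed (use t M N in \<open>auto simp: algebra_simps borel_prob_def prob_space.emeasure_le_1
       measure_pmf.finite_measure_axioms\<close>)

end

lemma measure_completion_Un_null:
  assumes "S \<in> sets P" "N \<subseteq> N'" "N' \<in> null_sets P"
  shows "measure (completion P) (S \<union> N) = measure P S"
proof -
  have "N \<in> null_sets (completion P)"
    using assms null_sets_completionI null_sets_completion_subset by blast
  then have "emeasure (completion P) (S \<union> N) = emeasure P S"
    using assms by (simp add: emeasure_Un_null_set)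
  then show ?thesis by (simp add: measure_def)
qed

text \<open>Both weights are positive, so a null set of the mixture is null for \<open>M\<close> and
  for \<open>N\<close>. Hence one Borel set \<open>S\<close> computes the completed measure of
  \<open>E\<close> in all three cases.\<close>

lemma measure_completion_mix_measure:
  assumes t: "0 < t" "t < 1" and M: "borel_prob M" and N: "borel_prob N"
    and E: "E \<in> sets (completion (mix_measure t M N))"
  shows "measure (completion (mix_measure t M N)) E =
    (1 - t) * measure (completion M) E + t * measure (completion N) E"
proof -
  have P: "borel_prob (mix_measure t M N)"
    using t M N by (simp add: borel_prob_mix_measure)
  note [simp] = P[unfolded borel_prob_def, THEN conjunct2] M[unfolded borel_prob_def, THEN conjunct2]
    N[unfolded borel_prob_def, THEN conjunct2]
  interpret P: prob_space "mix_measure t M N" using P by (simp add: borel_prob_def)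
  interpret M: prob_space M using M by (simp add: borel_prob_def)
  interpret N: prob_space N using N by (simp add: borel_prob_def)
  obtain S Z Z' where E_eq: "E = S \<union> Z" and Z: "Z \<subseteq> Z'" "Z' \<in> null_sets (mix_measure t M N)"
    and S: "S \<in> sets (mix_measure t M N)"
    using E by (rule sets_completionE)
  have Z': "Z' \<in> sets borel" using Z(2) by auto
  have "(1 - t) * measure M Z' + t * measure N Z' = 0"
    using Z(2) measure_mix_measure[of t M N Z'] t M N Z'
    by (simp add: null_sets_def P.emeasure_eq_measure)
  moreover have "(1 - t) * measure M Z' \<ge> 0" "t * measure N Z' \<ge> 0"
    using t by auto
  ultimately have "(1 - t) * measure M Z' = 0" "t * measure N Z' = 0" by linarith+
  then have "Z' \<in> null_sets M" "Z' \<in> null_sets N"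
    using t Z' by (auto simp: null_sets_def M.emeasure_eq_measure N.emeasure_eq_measure)
  then show ?thesis
    using S Z t M N by (simp add: E_eq measure_completion_Un_null measure_mix_measure)
qed

lemma invariant_mix_measure:
  fixes F :: "'a::metric_space \<Rightarrow> 'a set"
  assumes "compact (UNIV :: 'a set)" "set_valued_map F"
    and t: "0 < t" "t < 1" and M: "invariant_measure F M" and N: "invariant_measure F N"
  shows "invariant_measure F (mix_measure t M N)"
  unfolding invariant_measure_def
proof (intro conjI ballI)
  have MN: "borel_prob M" "borel_prob N"
    using M N by (auto simp: invariant_measure_def)
  then show P: "borel_prob (mix_measure t M N)"
    using t by (simp add: borel_prob_mix_measure)
  fix B :: "'a set" assume B: "B \<in> sets borel"
  have "measure (mix_measure t M N) B = (1 - t) * measure M B + t * measure N B"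
    using t MN B by (simp add: measure_mix_measure)
  also have "\<dots> \<le> (1 - t) * measure (completion M) (preimage_sv F B) + t * measure (completion N) (preimage_sv F B)"
    using M N B t by (intro add_mono mult_left_mono) (auto simp: invariant_measure_def)
  \<comment> \<open>The preimage need not be Borel; its measurability in the completion of the
    mixture itself is what permits splitting its measure.\<close>
  also have "\<dots> = measure (completion (mix_measure t M N)) (preimage_sv F B)"
    using preimage_sv_sets_completion[OF assms(1,2) P B] t MN
    by (simp add: measure_completion_mix_measure)
  finally show "measure (mix_measure t M N) B \<le> measure (completion (mix_measure t M N)) (preimage_sv F B)" .
qed

lemma full_support_mix_measure:
  assumes "0 < t" "t \<le> 1" "borel_prob M" "borel_prob N" "full_support N"
  shows "full_support (mix_measure t M N)"
  unfolding full_support_def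
proof (intro allI impI)
  fix U :: "'a set" assume "open U \<and> U \<noteq> {}"
  then show "measure (mix_measure t M N) U > 0"
    using assms by (auto simp: measure_mix_measure full_support_def intro!: add_nonneg_pos)
qed

section \<open>Invariant measures from periodic orbits\<close>

text \<open>The measure lives on the countable Borel set \<open>set_pmf p\<close>, so its completion
  measures every set and agrees there with \<open>p\<close>. Transport along \<open>id\<close>
  replaces the discrete sigma-algebra by the Borel one.\<close>

lemma invariant_measure_pmf:
  fixes F :: "'a::metric_space \<Rightarrow> 'a set"
  assumes "\<And>B. measure_pmf.prob p B \<le> measure_pmf.prob p (preimage_sv F B)"
  shows "invariant_measure F (distr (measure_pmf p) borel id)"
proof -
  let ?D = "distr (measure_pmf p) borel id"
  have D: "measure ?D B = measure_pmf.prob p B" if "B \<in> sets borel" for B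
    using that by (subst measure_distr) auto
  have cS: "A \<in> sets borel" if "countable A" for A :: "'a set"
    using that by (rule sets.countable[rotated]) auto
  have "measure (completion ?D) E = measure_pmf.prob p E" for E
  proof -
    have "- set_pmf p \<in> sets borel"
      using cS[OF countable_set_pmf] by (rule borel_comp)
    moreover have "emeasure (measure_pmf p) (- set_pmf p) = 0"
      by (metis Compl_disjoint emeasure_Int_set_pmf emeasure_empty inf_commute)
    ultimately have "- set_pmf p \<in> null_sets ?D"
      by (auto simp: null_sets_def emeasure_distr)
    moreover have S: "E \<inter> set_pmf p \<in> sets borel"
      by (rule cS) (simp add: countable_set_pmf)
    ultimately have "measure (completion ?D) ((E \<inter> set_pmf p) \<union> (E - set_pmf p)) = measure ?D (E \<inter> set_pmf p)"
      by (intro measure_completion_Un_null) auto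
    then show ?thesis
      using D[OF S] by (simp add: Int_Diff_Un measure_Int_set_pmf)
  qed
  then show ?thesis
    using assms D by (auto simp: invariant_measure_def borel_prob_def intro!: measure_pmf.prob_space_distr)
qed

text \<open>Take the uniform law on the times of one period, so that points are weighted by their
  visits. A shift of time preserves it, and \<open>xs (Suc j) \<in> B\<close> puts
  \<open>xs j\<close> into the preimage of \<open>B\<close>.\<close>

lemma periodic_orbit_pmf:
  assumes "has_periodic_orbit F x"
  shows "\<exists>q. x \<in> set_pmf q \<and> (\<forall>B. measure_pmf.prob q B \<le> measure_pmf.prob q (preimage_sv F B))"
proof -
  obtain xs p where xs: "xs 0 = x" "\<And>j. xs (Suc j) \<in> F (xs j)" and p: "p > 0" "\<And>j. xs (j + p) = xs j"
    using assms by (auto simp: has_periodic_orbit_def is_orbit_def periodic_seq_def)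
  let ?q = "map_pmf xs (pmf_of_set {..<p})"
  have p0: "{..<p} \<noteq> {}" using p(1) by auto
  have prob: "measure_pmf.prob ?q B = (\<Sum>j<p. indicator B (xs j)) / p" for B
    using p0 by (simp add: measure_pmf_of_set indicator_def sum.If_cases Int_def vimage_def)
  have shift: "(\<Sum>j<p. indicator B (xs (Suc j))) = (\<Sum>j<p. indicator B (xs j) :: real)" for B
  proof -
    \<comment> \<open>Both sides are the sum over the times \<open>0\<close> to \<open>p\<close>,
      split off at its first or its last term.\<close>
    have "(\<Sum>j<p. indicator B (xs (Suc j))) + indicator B (xs 0) = (\<Sum>j<p. indicator B (xs j)) + (indicator B (xs p) :: real)"
      using sum.lessThan_Suc_shift[of "\<lambda>j. indicat_real B (xs j)" p]
        sum.lessThan_Suc[of "\<lambda>j. indicat_real B (xs j)" p]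
      by linarith
    then show ?thesis using p(2)[of 0] by simp
  qed
  have "measure_pmf.prob ?q B \<le> measure_pmf.prob ?q (preimage_sv F B)" for B
  proof -
    have "(\<Sum>j<p. indicator B (xs (Suc j))) \<le> (\<Sum>j<p. indicator (preimage_sv F B) (xs j) :: real)"
      using xs(2) by (intro sum_mono) (auto simp: indicator_def preimage_sv_def)
    then show ?thesis
      unfolding prob shift by (intro divide_right_mono) auto
  qed
  moreover have "x \<in> set_pmf ?q"
    using p xs(1) p0 by auto
  ultimately show ?thesis by blast
qed

text \<open>The centres of finite nets need not lie in \<open>P\<close>, so each is moved to a
  nearby point of \<open>P\<close>; the net error and the displacement are each below
  \<open>inverse (Suc n)\<close>.\<close>

lemma compact_countable_dense_subset:
  fixes P :: "'a::metric_space set"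
  assumes "compact (UNIV :: 'a set)" "closure P = UNIV"
  obtains D where "D \<subseteq> P" "countable D" "closure D = UNIV"
proof -
  have "\<exists>k. finite k \<and> (UNIV :: 'a set) \<subseteq> (\<Union>x\<in>k. ball x (inverse (Suc n)))" for n
    using assms(1) unfolding compact_eq_totally_bounded by simp
  then obtain k where k: "\<And>n. finite (k n)" "\<And>n. (UNIV :: 'a set) \<subseteq> (\<Union>x\<in>k n. ball x (inverse (Suc n)))"
    by metis
  have "\<exists>y\<in>P. dist y x < inverse (Suc n)" for x n
    using assms(2) closure_approachable[of x P] by simp
  then obtain g where g: "\<And>x n. g x n \<in> P" "\<And>x n. dist (g x n) x < inverse (Suc n)"
    by metis
  define D where "D = (\<Union>n. (\<lambda>x. g x n) ` k n)"
  have "x \<in> closure D" for x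
    unfolding closure_approachable
  proof (intro allI impI)
    fix e :: real assume "e > 0"
    then obtain n where n: "inverse (Suc n) < e / 2"
      using reals_Archimedean[of "e / 2"] by auto
    obtain y where y: "y \<in> k n" "dist y x < inverse (Suc n)"
      using k(2)[of n] by (meson UNIV_I UN_E mem_ball subsetD)
    have "dist (g y n) x < e"
      using g(2)[of y n] y(2) n dist_triangle[of "g y n" x y] by linarith
    then show "\<exists>y\<in>D. dist y x < e"
      using y(1) by (auto simp: D_def)
  qed
  then show ?thesis
    using that[of D] g(1) k(1) by (auto simp: D_def countable_finite)
qed

text \<open>Averaging over \<open>D\<close> with positive weights preserves the invariance
  inequality and makes every point of the dense set \<open>D\<close> an atom.\<close>

lemma exists_full_support_invariant:
  fixes F :: "'a::metric_space \<Rightarrow> 'a set"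
  assumes "countable D" "closure D = UNIV" "D \<subseteq> {x. has_periodic_orbit F x}"
  shows "\<exists>M. invariant_measure F M \<and> full_support M"
proof -
  have D0: "D \<noteq> {}" using assms(2) by auto
  \<comment> \<open>The geometric law charges every natural number, so its image charges all of
    \<open>D\<close>; a finite \<open>D\<close> is covered too, being enumerated with
    repetitions.\<close>
  define r where "r = map_pmf (from_nat_into D) (geometric_pmf (1/2))"
  have r: "set_pmf r = D"
    using assms(1) D0 by (simp add: r_def set_pmf_geometric range_from_nat_into)
  have "\<exists>q. x \<in> D \<longrightarrow> x \<in> set_pmf q \<and> (\<forall>B. measure_pmf.prob q B \<le> measure_pmf.prob q (preimage_sv F B))" for x
    using periodic_orbit_pmf[of F x] assms(3) by blast
  then obtain q where q: "\<And>x. x \<in> D \<Longrightarrow> x \<in> set_pmf (q x)"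
    "\<And>x B. x \<in> D \<Longrightarrow> measure_pmf.prob (q x) B \<le> measure_pmf.prob (q x) (preimage_sv F B)"
    by metis
  define p where "p = bind_pmf r q"
  have "measure_pmf.prob p B \<le> measure_pmf.prob p (preimage_sv F B)" for B
  proof -
    have "emeasure (measure_pmf p) B \<le> emeasure (measure_pmf p) (preimage_sv F B)"
      unfolding p_def emeasure_bind_pmf
      by (intro nn_integral_mono_AE) (auto simp: AE_measure_pmf_iff r measure_pmf.emeasure_eq_measure q(2))
    then show ?thesis by (simp add: measure_pmf.emeasure_eq_measure)
  qed
  then have "invariant_measure F (distr (measure_pmf p) borel id)"
    by (rule invariant_measure_pmf)
  moreover have "full_support (distr (measure_pmf p) borel id)"
    unfolding full_support_def
  proof (intro allI impI)
    fix U :: "'a set" assume U: "open U \<and> U \<noteq> {}"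
    then obtain d where d: "d \<in> D" "d \<in> U"
      using assms(2) open_Int_closure_eq_empty[of U D] by auto
    then have "d \<in> set_pmf p"
      using q(1) r by (auto simp: p_def)
    with d(2) have "measure_pmf.prob p U > 0"
      by (rule measure_pmf_posI[rotated 1])
    then show "measure (distr (measure_pmf p) borel id) U > 0"
      using U by (subst measure_distr) auto
  qed
  ultimately show ?thesis by blast
qed

section \<open>The weak* topology: the G-delta property and density\<close>

lemma topspace_weak_star_topology: "topspace (weak_star_topology P) = P"
proof -
  \<comment> \<open>The zero function with \<open>V = UNIV\<close> makes \<open>P\<close> itself a
    generator.\<close>
  have "P \<in> {{M \<in> P. (\<integral>x. f x \<partial>M) \<in> V} | f V. continuous_on UNIV f \<and> open (V :: real set)}"
    by (rule CollectI, rule exI[of _ "\<lambda>_. 0"], rule exI[of _ UNIV]) simp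
  then show ?thesis
    unfolding weak_star_topology_def topology_generated_by_topspace by auto
qed

lemma openin_weak_star_integral_pos:
  "continuous_on UNIV f \<Longrightarrow> openin (weak_star_topology P) {M \<in> P. (\<integral>x. f x \<partial>M) > (0::real)}"
  unfolding weak_star_topology_def
  by (rule topology_generated_by_Basis, rule CollectI, rule exI[of _ f], rule exI[of _ "{0<..}"]) simp

text \<open>A nonnegative continuous function that vanishes exactly off \<open>U\<close> has
  positive integral iff \<open>U\<close> has positive measure. The truncated distance to the
  complement is such a function, and is bounded.\<close>

lemma openin_weak_star_open_pos:
  fixes U :: "'a::metric_space set"
  assumes P: "\<And>M. M \<in> P \<Longrightarrow> borel_prob M" and U: "open U"
  shows "openin (weak_star_topology P) {M \<in> P. measure M U > 0}"
\<comment> \<open>The distance to the empty set is \<open>0\<close> by convention, so the whole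
  space is treated apart.\<close>
proof (cases "U = UNIV")
  case True
  have "{M \<in> P. measure M U > 0} = topspace (weak_star_topology P)"
    using P prob_space.prob_space borel_prob_space
    by (force simp: True topspace_weak_star_topology borel_prob_def)
  then show ?thesis by (metis openin_topspace)
next
  case False
  define f where "f x = min 1 (infdist x (- U))" for x
  have cont: "continuous_on UNIV f"
    unfolding f_def by (intro continuous_intros)
  have "x \<notin> U \<longleftrightarrow> infdist x (- U) = 0" for x
    using in_closed_iff_infdist_zero[of "- U" x] U False by auto
  then have f: "0 \<le> f x" "f x \<le> 1" "f x = 0 \<longleftrightarrow> x \<notin> U" for x
    by (auto simp: f_def infdist_nonneg min_def)
  have "(\<integral>x. f x \<partial>M) > 0 \<longleftrightarrow> measure M U > 0" if "M \<in> P" for M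
  proof -
    interpret prob_space M using P[OF that] by (simp add: borel_prob_def)
    have sets_M[measurable_cong, simp]: "sets M = sets borel" and space_M: "space M = UNIV"
      using P[OF that] borel_prob_space by (auto simp: borel_prob_def)
    have [measurable]: "f \<in> borel_measurable M"
      using borel_measurable_continuous_onI[OF cont] by simp
    have int: "integrable M f"
      by (rule integrable_const_bound[of _ 1]) (use f in auto)
    have "(\<integral>x. f x \<partial>M) = 0 \<longleftrightarrow> (AE x in M. f x = 0)"
      by (rule integral_nonneg_eq_0_iff_AE[OF int]) (use f in auto)
    also have "\<dots> \<longleftrightarrow> (AE x in M. x \<notin> U)"
      by (simp add: f)
    also have "\<dots> \<longleftrightarrow> measure M U = 0"
      using U by (subst AE_iff_measurable[OF _ refl]) (auto simp: space_M emeasure_eq_measure)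
    finally show ?thesis
      using integral_nonneg_AE[of f M] f(1) by (auto simp: less_le)
  qed
  then have "{M \<in> P. measure M U > 0} = {M \<in> P. (\<integral>x. f x \<partial>M) > 0}"
    by auto
  then show ?thesis using openin_weak_star_integral_pos[OF cont] by simp
qed

text \<open>Every nonempty open set contains a ball \<open>ball d (inverse (Suc n))\<close> with
  \<open>d \<in> D\<close>, so full support amounts to countably many open conditions.\<close>

lemma gdelta_in_full_support:
  fixes P :: "'a::metric_space measure set"
  assumes P: "\<And>M. M \<in> P \<Longrightarrow> borel_prob M" and D: "countable D" "closure D = (UNIV :: 'a set)"
  shows "gdelta_in (weak_star_topology P) {M \<in> P. full_support M}"
proof -
  let ?O = "\<lambda>(d, n::nat). {M \<in> P. measure M (ball d (inverse (Suc n))) > 0}"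
  have "M \<in> P \<and> full_support M \<longleftrightarrow> (\<forall>z\<in>D \<times> UNIV. M \<in> ?O z)" for M
  proof (intro iffI conjI ballI)
    show "M \<in> ?O z" if "M \<in> P \<and> full_support M" for z
      using that by (cases z) (auto simp: full_support_def)
    assume M: "\<forall>z\<in>D \<times> UNIV. M \<in> ?O z"
    \<comment> \<open>Membership in \<open>P\<close> is part of each \<open>?O z\<close>, so one
      index is enough to recover it.\<close>
    obtain d0 where "d0 \<in> D" using D(2) by fastforce
    with M show MP: "M \<in> P" by auto
    then have [simp]: "sets M = sets borel" using P by (simp add: borel_prob_def)
    interpret prob_space M using P[OF MP] by (simp add: borel_prob_def)
    show "full_support M"
      unfolding full_support_def
    proof (intro allI impI)
      fix U :: "'a set" assume U: "open U \<and> U \<noteq> {}"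
      then obtain d where d: "d \<in> D" "d \<in> U"
        using D(2) open_Int_closure_eq_empty[of U D] by auto
      obtain e where e: "e > 0" "ball d e \<subseteq> U"
        using U d(2) open_contains_ball by blast
      obtain n where n: "inverse (Suc n) < e"
        using reals_Archimedean[OF e(1)] by auto
      have "0 < measure M (ball d (inverse (Suc n)))"
        using M d(1) by auto
      also have "ball d (inverse (Suc n)) \<subseteq> U"
        using subset_ball[of "inverse (Suc n)" e d] e(2) n by simp
      then have "measure M (ball d (inverse (Suc n))) \<le> measure M U"
        using U by (intro finite_measure_mono) auto
      finally show "0 < measure M U" .
    qed
  qed
  then have "{M \<in> P. full_support M} = \<Inter> (?O ` (D \<times> UNIV))"
    by blast
  moreover have "gdelta_in (weak_star_topology P) (\<Inter> (?O ` (D \<times> UNIV)))"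
  proof (rule gdelta_in_Inter)
    show "countable (?O ` (D \<times> UNIV))" using D(1) by simp
    show "?O ` (D \<times> UNIV) \<noteq> {}" using D(2) by auto
    show "gdelta_in (weak_star_topology P) T" if "T \<in> ?O ` (D \<times> UNIV)" for T
      using that openin_weak_star_open_pos[of P] P by (auto intro!: open_imp_gdelta_in)
  qed
  ultimately show ?thesis by simp
qed

text \<open>By induction on the generation of \<open>W\<close>. On a generator, the integral of
  \<open>f\<close> against the mixture is affine in \<open>t\<close> and tends to the integral
  against \<open>M\<close>; compactness bounds \<open>f\<close>, as the integral formula
  requires.\<close>

lemma mix_measure_eventually_in_open:
  fixes M N :: "'a::metric_space measure"
  assumes cpt: "compact (UNIV :: 'a set)" and MN: "borel_prob M" "borel_prob N"
    and P: "\<And>t. 0 < t \<Longrightarrow> t < 1 \<Longrightarrow> mix_measure t M N \<in> P"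
    and W: "openin (weak_star_topology P) W" "M \<in> W"
  shows "\<forall>\<^sub>F t in at_right 0. mix_measure t M N \<in> W"
proof -
  have t01: "\<forall>\<^sub>F t::real in at_right 0. 0 < t \<and> t < 1"
    by (auto simp: eventually_at_right_field intro!: exI[of _ 1])
  have "generate_topology_on {{M \<in> P. (\<integral>x. f x \<partial>M) \<in> V} | f V. continuous_on UNIV f \<and> open (V :: real set)} W"
    using W(1) unfolding weak_star_topology_def by (rule openin_topology_generated_by)
  then show ?thesis using W(2)
  proof induction
    case (Int a b)
    then show ?case by (auto intro: eventually_conj)
  next
    case (UN K)
    then obtain k where "k \<in> K" "M \<in> k" by blast
    with UN.IH have "\<forall>\<^sub>F t in at_right 0. mix_measure t M N \<in> k" by blast
    then show ?case by (rule eventually_mono) (use \<open>k \<in> K\<close> in blast)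
  next
    case (Basis s)
    then obtain f V where s: "s = {M \<in> P. (\<integral>x. f x \<partial>M) \<in> V}" "continuous_on UNIV f" "open (V :: real set)"
      by blast
    have "compact (range f)"
      using compact_continuous_image[OF s(2) cpt] .
    then obtain c where c: "\<And>x. \<bar>f x\<bar> \<le> c"
      using compact_imp_bounded[of "range f"] by (auto simp: bounded_iff)
    have "((\<lambda>t. (1 - t) * integral\<^sup>L M f + t * integral\<^sup>L N f) \<longlongrightarrow> (1 - 0) * integral\<^sup>L M f + 0 * integral\<^sup>L N f) (at_right 0)"
      by (intro tendsto_intros)
    moreover have "(1 - 0) * integral\<^sup>L M f + 0 * integral\<^sup>L N f \<in> V"
      using Basis.prems s(1) by simp
    ultimately have "\<forall>\<^sub>F t in at_right 0. (1 - t) * integral\<^sup>L M f + t * integral\<^sup>L N f \<in> V"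
      by (rule topological_tendstoD[OF _ s(3)])
    with t01 show ?case
    proof eventually_elim
      case (elim t)
      then show ?case
        using P[of t] MN borel_measurable_continuous_onI[OF s(2)]
        by (simp add: s(1) integral_mix_measure[OF _ _ MN _ c])
    qed
  qed simp
qed

theorem theorem14:
  fixes F :: "'a::metric_space \<Rightarrow> 'a set"
  assumes "compact (UNIV :: 'a set)"
    and "set_valued_map F"
    and "closure {x. has_periodic_orbit F x} = UNIV"
  shows "(\<exists>M. invariant_measure F M \<and> full_support M) \<and>
         (let T = weak_star_topology {M. invariant_measure F M};
              S = {M. invariant_measure F M \<and> full_support M}
          in gdelta_in T S \<and> T closure_of S = topspace T)"
proof -
  let ?P = "{M. invariant_measure F M}"
  let ?T = "weak_star_topology ?P"
  let ?S = "{M. invariant_measure F M \<and> full_support M}"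
  obtain D where D: "D \<subseteq> {x. has_periodic_orbit F x}" "countable D" "closure D = UNIV"
    using compact_countable_dense_subset[OF assms(1,3)] .
  then obtain N where N: "invariant_measure F N" "full_support N"
    using exists_full_support_invariant by blast
  have bp: "borel_prob M" if "invariant_measure F M" for M
    using that by (simp add: invariant_measure_def)
  have "gdelta_in ?T ?S"
    using gdelta_in_full_support[of ?P D] bp D by simp
  moreover have "?T closure_of ?S = topspace ?T"
  proof (rule subset_antisym[OF closure_of_subset_topspace], rule subsetI)
    fix M assume "M \<in> topspace ?T"
    then have M: "invariant_measure F M" by (simp add: topspace_weak_star_topology)
    show "M \<in> ?T closure_of ?S"
      unfolding in_closure_of
    proof (intro conjI allI impI)
      show "M \<in> topspace ?T" by fact
      fix W assume W: "M \<in> W \<and> openin ?T W"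
      have inv: "invariant_measure F (mix_measure t M N)" if "0 < t" "t < 1" for t
        using invariant_mix_measure[OF assms(1,2) that M N(1)] .
      have "\<forall>\<^sub>F t in at_right 0. mix_measure t M N \<in> W"
        using W inv by (intro mix_measure_eventually_in_open[OF assms(1) bp[OF M] bp[OF N(1)], of ?P]) auto
      moreover have "\<forall>\<^sub>F t::real in at_right 0. 0 < t \<and> t < 1"
        by (auto simp: eventually_at_right_field intro!: exI[of _ 1])
      ultimately have "\<forall>\<^sub>F t in at_right 0. mix_measure t M N \<in> W \<and> 0 < t \<and> t < 1"
        by (rule eventually_conj)
      \<comment> \<open>The filter \<open>at_right 0\<close> is nontrivial, so an eventual property
        is attained.\<close>
      then obtain t where t: "mix_measure t M N \<in> W" "0 < t" "t < 1"
        using eventually_happens'[of "at_right (0::real)"] by force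
      then show "\<exists>y. y \<in> ?S \<and> y \<in> W"
        using inv full_support_mix_measure[of t M N] bp M N by auto
    qed
  qed
  ultimately show ?thesis
    using N by (auto simp: Let_def)
qed

end
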